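(* Let $X$ be a compact $\ell_1$-convex subset of $\mathbb{R}^n$ and $\lambda\geq 0$. Then for $0\leq k\leq n$, \[ V_k(X+\lambda Q_n)=\sum_{i=0}^k \binom{n-i}{n-k} V_i(X)\lambda^{k-i}, \] and in particular $\mathrm{Vol}(X+\lambda Q_n)=\sum_{i=0}^n V_i(X)\lambda^{n-i}$.
   Context: $Q_n=[-\tfrac12,\tfrac12]^n$ is the unit cube and $+$ is Minkowski sum. A subset $X\subseteq\mathbb{R}^n$ is $\ell_1$-convex if for all $x,x'\in X$, with $D=\sum_i|x_i-x'_i|$, there is a map $\gamma\colon[0,D]\to X$ with $\gamma(0)=x$, $\gamma(D)=x'$ preserving distances for the $\ell_1$ metric $d(x,y)=\sum_i|x_i-y_i|$. For $0\le i\le n$, $G_{n,i}$ denotes the set of $i$-dimensional coordinate subspaces of $\mathbb{R}^n$ (spanned by $i$ standard basis vectors), $\pi_P$ orthogonal projection onto $P$, and the $i$th $\ell_1$-intrinsic volume of a compact $\ell_1$-convex set $Y$ is $V_i(Y)=\sum_{P\in G_{n,i}}\mathrm{Vol}_i(\pi_PY)$ with $\mathrm{Vol}_i$ Lebesgue measure on $P$. (It is known that $X+\lambda Q_n$ is again compact $\ell_1$-convex.) *)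

theory Defs
  imports "HOL-Analysis.Analysis"
begin

text \<open>The l1 distance on R^n, with R^n rendered as real^'n.\<close>
definition l1_dist :: "real^'n \<Rightarrow> real^'n \<Rightarrow> real" where
  "l1_dist x y = (\<Sum>i\<in>UNIV. \<bar>x$i - y$i\<bar>)"

text \<open>l1-convexity: any two points are joined by an l1-geodesic inside X.\<close>
definition l1_convex :: "(real^'n) set \<Rightarrow> bool" where
  "l1_convex X \<longleftrightarrow> (\<forall>x\<in>X. \<forall>x'\<in>X. \<exists>\<gamma> :: real \<Rightarrow> real^'n.
      \<gamma> 0 = x \<and> \<gamma> (l1_dist x x') = x' \<and> \<gamma> ` {0..l1_dist x x'} \<subseteq> X \<and>
      (\<forall>s\<in>{0..l1_dist x x'}. \<forall>t\<in>{0..l1_dist x x'}. l1_dist (\<gamma> s) (\<gamma> t) = \<bar>s - t\<bar>))"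

text \<open>The unit cube Q_n = [-1/2,1/2]^n.\<close>
definition unit_cube :: "(real^'n) set" where
  "unit_cube = {x. \<forall>i. \<bar>x$i\<bar> \<le> 1/2}"

text \<open>Minkowski sum.\<close>
definition minkowski_sum :: "(real^'n) set \<Rightarrow> (real^'n) set \<Rightarrow> (real^'n) set" where
  "minkowski_sum A B = {a + b | a b. a \<in> A \<and> b \<in> B}"

text \<open>Orthogonal projection onto the coordinate subspace spanned by the coordinates in P,
  identified with the space of functions P \<rightarrow> R (extensional), whose Lebesgue measure is
  the product measure PiM P (\<lambda>_. lborel).\<close>
definition coord_proj :: "'n set \<Rightarrow> real^'n \<Rightarrow> ('n \<Rightarrow> real)" where
  "coord_proj P x = restrict (\<lambda>j. x$j) P"

text \<open>i-dimensional volume of the projection of Y onto the coordinate subspace P.\<close>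
definition proj_vol :: "'n set \<Rightarrow> (real^'n) set \<Rightarrow> real" where
  "proj_vol P Y = measure (PiM P (\<lambda>_. lborel)) (coord_proj P ` Y)"

text \<open>i-th l1-intrinsic volume: sum over the i-dimensional coordinate subspaces.\<close>
definition l1_intrinsic_volume :: "nat \<Rightarrow> (real^'n) set \<Rightarrow> real" where
  "l1_intrinsic_volume i Y = (\<Sum>P\<in>{P :: 'n set. card P = i}. proj_vol P Y)"

end

theory Submission
  imports Defs
begin

text \<open>
  The cube \<open>\<lambda>Q\<^sub>n\<close> is the box with half-widths \<open>\<lambda>/2\<close>, and the box can be grown one coordinate
  at a time. Fix a coordinate subspace \<open>P\<close> and \<open>j \<in> P\<close>. By Fubini, the volume of the projection
  onto \<open>P\<close> is the integral, over the projection onto \<open>P - {j}\<close>, of the lengths of the fibres in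
  direction \<open>j\<close>. An \<open>\<ell>\<^sub>1\<close>-geodesic stays in the coordinate box spanned by its endpoints; by the
  intermediate value theorem this makes every fibre a compact interval, so widening the box by
  \<open>c\<close> in direction \<open>j\<close> lengthens each non-empty fibre by exactly \<open>2c\<close>. Hence the projected volume
  grows by \<open>2c\<close> times the volume of the projection onto \<open>P - {j}\<close>, and induction over the
  coordinates of \<open>P\<close> gives \<open>Vol\<^sub>P(X + \<lambda>Q\<^sub>n) = \<Sum>\<^sub>R\<^sub>\<subseteq>\<^sub>P Vol\<^sub>R(X) \<lambda>\<^bsup>|P|-|R|\<^esup>\<close>. Summing over all \<open>P\<close> with
  \<open>|P| = k\<close>, a fixed \<open>R\<close> with \<open>|R| = i\<close> is counted \<open>(n-i choose k-i)\<close> times.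
\<close>

section \<open>Geodesics stay in coordinate boxes\<close>

definition box_path_connected :: "(real^'n) set \<Rightarrow> bool" where
  "box_path_connected X \<longleftrightarrow> (\<forall>x\<in>X. \<forall>y\<in>X. \<exists>(D::real) \<gamma>. 0 \<le> D \<and> continuous_on {0..D} \<gamma> \<and>
     \<gamma> 0 = x \<and> \<gamma> D = y \<and> \<gamma> ` {0..D} \<subseteq> X \<inter> cbox (inf x y) (sup x y))"

lemma l1_dist_nonneg: "0 \<le> l1_dist x y"
  unfolding l1_dist_def by (auto intro: sum_nonneg)

lemma dist_le_l1_dist: "dist x y \<le> l1_dist x y"
  using norm_le_l1_cart[of "x - y"] by (simp add: dist_norm l1_dist_def)

lemma l1_dist_add_eq_imp_mem_cbox:
  assumes "l1_dist x z + l1_dist z y = l1_dist x y"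
  shows "z \<in> cbox (inf x y) (sup x y)"
proof -
  have tight: "\<bar>x$i - z$i\<bar> + \<bar>z$i - y$i\<bar> = \<bar>x$i - y$i\<bar>" for i
  proof (rule ccontr)
    assume "\<not> ?thesis"
    then have "\<bar>x$i - y$i\<bar> < \<bar>x$i - z$i\<bar> + \<bar>z$i - y$i\<bar>" by linarith
    then have "(\<Sum>i\<in>UNIV. \<bar>x$i - y$i\<bar>) < (\<Sum>i\<in>UNIV. \<bar>x$i - z$i\<bar> + \<bar>z$i - y$i\<bar>)"
      by (intro sum_strict_mono_ex1) (auto intro: abs_triangle_ineq[THEN order.trans[rotated]])
    with assms show False by (simp add: l1_dist_def sum.distrib)
  qed
  have "inf (x$i) (y$i) \<le> z$i \<and> z$i \<le> sup (x$i) (y$i)" for i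
    using tight[of i] by (auto simp: inf_min sup_max abs_if min_def max_def split: if_splits)
  then show ?thesis
    by (simp add: mem_box_cart inf_vec_def sup_vec_def)
qed

lemma l1_convex_imp_box_path_connected:
  assumes "l1_convex X"
  shows "box_path_connected X"
  unfolding box_path_connected_def
proof (intro ballI)
  fix x y assume "x \<in> X" "y \<in> X"
  define D where "D = l1_dist x y"
  obtain \<gamma> where \<gamma>0: "\<gamma> 0 = x" and \<gamma>D: "\<gamma> D = y" and \<gamma>X: "\<gamma> ` {0..D} \<subseteq> X"
    and isometric: "\<forall>s\<in>{0..D}. \<forall>t\<in>{0..D}. l1_dist (\<gamma> s) (\<gamma> t) = \<bar>s - t\<bar>"
    using assms \<open>x \<in> X\<close> \<open>y \<in> X\<close> unfolding l1_convex_def D_def by blast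
  have "0 \<le> D" unfolding D_def by (rule l1_dist_nonneg)
  have "1-lipschitz_on {0..D} \<gamma>"
  proof (rule lipschitz_onI)
    fix s t assume "s \<in> {0..D}" "t \<in> {0..D}"
    then show "dist (\<gamma> s) (\<gamma> t) \<le> 1 * dist s t"
      using dist_le_l1_dist[of "\<gamma> s" "\<gamma> t"] isometric by (simp add: dist_real_def)
  qed simp
  then have "continuous_on {0..D} \<gamma>" by (rule lipschitz_on_continuous_on)
  moreover have "\<gamma> t \<in> cbox (inf x y) (sup x y)" if "t \<in> {0..D}" for t
  proof (rule l1_dist_add_eq_imp_mem_cbox)
    have "l1_dist x (\<gamma> t) = t" "l1_dist (\<gamma> t) y = D - t"
      using that \<open>0 \<le> D\<close> isometric \<gamma>0 \<gamma>D by force+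
    then show "l1_dist x (\<gamma> t) + l1_dist (\<gamma> t) y = l1_dist x y" by (simp add: D_def)
  qed
  ultimately show "\<exists>(D::real) \<gamma>. 0 \<le> D \<and> continuous_on {0..D} \<gamma> \<and>
     \<gamma> 0 = x \<and> \<gamma> D = y \<and> \<gamma> ` {0..D} \<subseteq> X \<inter> cbox (inf x y) (sup x y)"
    using \<open>0 \<le> D\<close> \<gamma>0 \<gamma>D \<gamma>X by (intro exI[of _ D] exI[of _ \<gamma>]) blast
qed

section \<open>Box thickenings and their fibres\<close>

text \<open>Half-widths may differ between coordinates; \<open>\<lambda>Q\<^sub>n\<close> is \<open>centred_box (\<lambda>_. \<lambda>/2)\<close>.\<close>

definition centred_box :: "('n \<Rightarrow> real) \<Rightarrow> (real^'n) set" where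
  "centred_box a = {b. \<forall>i. \<bar>b$i\<bar> \<le> a i}"

definition box_thickening :: "(real^'n) set \<Rightarrow> ('n \<Rightarrow> real) \<Rightarrow> (real^'n) set" where
  "box_thickening X a = minkowski_sum X (centred_box a)"

lemma centred_box_eq_cbox: "centred_box a = cbox (- (\<chi> i. a i)) (\<chi> i. a i)"
proof -
  have "\<bar>x\<bar> \<le> y \<longleftrightarrow> - y \<le> x \<and> x \<le> y" for x y :: real by auto
  then show ?thesis unfolding centred_box_def set_eq_iff mem_box_cart by simp
qed

lemma centred_box_zero: "centred_box (\<lambda>_. 0) = {0}"
  by (auto simp: centred_box_def vec_eq_iff)

lemma compact_box_thickening: "compact X \<Longrightarrow> compact (box_thickening X a)"
  unfolding box_thickening_def minkowski_sum_def centred_box_eq_cbox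
  by (intro compact_sums) auto

lemma box_thickening_zero: "box_thickening X (\<lambda>_. 0) = X"
  by (auto simp: box_thickening_def minkowski_sum_def centred_box_zero)

lemma scaleR_unit_cube:
  assumes "0 \<le> lam"
  shows "(*\<^sub>R) lam ` unit_cube = centred_box (\<lambda>_. lam / 2)"
proof (cases "lam = 0")
  case True
  moreover have "0 \<in> unit_cube" by (simp add: unit_cube_def)
  ultimately show ?thesis by (auto simp: centred_box_zero)
next
  case False
  with assms have "0 < lam" by simp
  have coordinate: "\<bar>(lam *\<^sub>R u)$i\<bar> \<le> lam / 2 \<longleftrightarrow> \<bar>u$i\<bar> \<le> 1/2" for u :: "real^'n" and i
    using \<open>0 < lam\<close> by (simp add: abs_mult)
  have scaled: "lam *\<^sub>R u \<in> centred_box (\<lambda>_. lam / 2) \<longleftrightarrow> u \<in> unit_cube" for u :: "real^'n"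
    by (simp only: centred_box_def unit_cube_def mem_Collect_eq coordinate)
  have rescale: "b = lam *\<^sub>R (inverse lam *\<^sub>R b)" for b :: "real^'n"
    using \<open>0 < lam\<close> by simp
  show ?thesis
  proof (intro equalityI subsetI)
    fix b :: "real^'n" assume "b \<in> (*\<^sub>R) lam ` unit_cube"
    then show "b \<in> centred_box (\<lambda>_. lam / 2)" using scaled by blast
  next
    fix b :: "real^'n" assume "b \<in> centred_box (\<lambda>_. lam / 2)"
    then have "inverse lam *\<^sub>R b \<in> unit_cube" using scaled rescale by metis
    then show "b \<in> (*\<^sub>R) lam ` unit_cube" using rescale by blast
  qed
qed

lemma mem_coord_proj_box_thickening_iff:
  assumes "\<forall>i. 0 \<le> a i"
  shows "h \<in> coord_proj P ` box_thickening X a \<longleftrightarrow>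
         h \<in> extensional P \<and> (\<exists>w\<in>X. \<forall>i\<in>P. \<bar>h i - w$i\<bar> \<le> a i)"
proof
  assume "h \<in> coord_proj P ` box_thickening X a"
  then obtain w b where "w \<in> X" "b \<in> centred_box a" "h = coord_proj P (w + b)"
    unfolding box_thickening_def minkowski_sum_def by blast
  then show "h \<in> extensional P \<and> (\<exists>w\<in>X. \<forall>i\<in>P. \<bar>h i - w$i\<bar> \<le> a i)"
    by (auto simp: coord_proj_def centred_box_def intro!: bexI[of _ w])
next
  assume "h \<in> extensional P \<and> (\<exists>w\<in>X. \<forall>i\<in>P. \<bar>h i - w$i\<bar> \<le> a i)"
  then obtain w where "h \<in> extensional P" "w \<in> X" and near: "\<forall>i\<in>P. \<bar>h i - w$i\<bar> \<le> a i"
    by blast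
  define b where "b = (\<chi> i. if i \<in> P then h i - w$i else 0)"
  have "b \<in> centred_box a" using near assms by (simp add: centred_box_def b_def)
  moreover have "h = coord_proj P (w + b)"
    using \<open>h \<in> extensional P\<close> by (auto simp: coord_proj_def b_def extensional_def)
  ultimately show "h \<in> coord_proj P ` box_thickening X a"
    using \<open>w \<in> X\<close> unfolding box_thickening_def minkowski_sum_def by blast
qed

lemma coord_proj_box_thickening_restrict:
  assumes "\<forall>i. 0 \<le> a i"
  shows "coord_proj P ` box_thickening X a =
         coord_proj P ` box_thickening X (\<lambda>i. if i \<in> P then a i else 0)"
  using assms by (auto simp: set_eq_iff mem_coord_proj_box_thickening_iff)

definition fibre :: "'n set \<Rightarrow> 'n \<Rightarrow> (real^'n) set \<Rightarrow> ('n \<Rightarrow> real) \<Rightarrow> real set" where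
  "fibre P j Y g = {y. g(j := y) \<in> coord_proj P ` Y}"

lemma coord_proj_apply: "coord_proj P z i = (if i \<in> P then z$i else undefined)"
  by (simp add: coord_proj_def)

lemma fibre_eq_image:
  fixes Y :: "(real^'n) set"
  assumes "j \<in> P" and "g \<in> extensional (P - {j})"
  shows "fibre P j Y g = (\<lambda>z. z$j) ` {z\<in>Y. \<forall>i\<in>P - {j}. z$i = g i}"
proof -
  have "g(j := y) = coord_proj P z \<longleftrightarrow> z$j = y \<and> (\<forall>i\<in>P - {j}. z$i = g i)" for y z
    using assms by (auto simp: fun_eq_iff coord_proj_apply extensional_def)
  then show ?thesis unfolding fibre_def by (fastforce simp: image_iff)
qed

lemma compact_fibre:
  fixes Y :: "(real^'n) set"
  assumes "compact Y" and "j \<in> P" and "g \<in> extensional (P - {j})"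
  shows "compact (fibre P j Y g)"
proof -
  have "closed {z::real^'n. \<forall>i\<in>P - {j}. z$i = g i}"
    by (simp add: Collect_ball_eq closed_INT closed_Collect_eq continuous_on_component)
  then have "compact {z\<in>Y. \<forall>i\<in>P - {j}. z$i = g i}"
    using \<open>compact Y\<close> compact_Int_closed by (simp add: Collect_conj_eq)
  then show ?thesis
    unfolding fibre_eq_image[OF assms(2,3)]
    by (intro compact_continuous_image continuous_on_component continuous_on_id)
qed

lemma fibre_eq_empty_iff:
  fixes Y :: "(real^'n) set"
  assumes "j \<in> P" and "g \<in> extensional (P - {j})"
  shows "fibre P j Y g = {} \<longleftrightarrow> g \<notin> coord_proj (P - {j}) ` Y"
proof -
  have "g = coord_proj (P - {j}) z \<longleftrightarrow> (\<forall>i\<in>P - {j}. z$i = g i)" for z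
    using assms by (auto simp: fun_eq_iff coord_proj_apply extensional_def)
  then show ?thesis unfolding fibre_eq_image[OF assms] by (fastforce simp: image_iff)
qed

lemma mem_fibre_box_thickening_iff:
  fixes X :: "(real^'n) set"
  assumes "j \<in> P" and "\<forall>i. 0 \<le> a i"
  shows "y \<in> fibre P j (box_thickening X a) g \<longleftrightarrow> (\<forall>i. i \<notin> P \<longrightarrow> g i = undefined) \<and>
           (\<exists>w\<in>X. \<bar>y - w$j\<bar> \<le> a j \<and> (\<forall>i\<in>P - {j}. \<bar>g i - w$i\<bar> \<le> a i))"
proof -
  have "g(j := y) \<in> extensional P \<longleftrightarrow> (\<forall>i. i \<notin> P \<longrightarrow> g i = undefined)"
    using assms(1) by (auto simp: extensional_def)
  moreover have "(\<forall>i\<in>P. \<bar>(g(j := y)) i - w$i\<bar> \<le> a i) \<longleftrightarrow>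
      \<bar>y - w$j\<bar> \<le> a j \<and> (\<forall>i\<in>P - {j}. \<bar>g i - w$i\<bar> \<le> a i)" for w :: "real^'n"
    using assms(1) by auto
  ultimately show ?thesis
    unfolding fibre_def mem_Collect_eq mem_coord_proj_box_thickening_iff[OF assms(2)] by simp
qed

lemma abs_diff_le_if_between:
  fixes p u v w r :: real
  assumes "min u v \<le> w" "w \<le> max u v" "\<bar>p - u\<bar> \<le> r" "\<bar>p - v\<bar> \<le> r"
  shows "\<bar>p - w\<bar> \<le> r"
  using assms by (auto simp: min_def max_def abs_le_iff split: if_splits)

lemma is_interval_fibre_box_thickening:
  fixes X :: "(real^'n) set"
  assumes X: "box_path_connected X" and a: "\<forall>i. 0 \<le> a i" and "j \<in> P"
  shows "is_interval (fibre P j (box_thickening X a) g)"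
  unfolding is_interval_1
proof (intro ballI allI impI)
  note fibre_iff = mem_fibre_box_thickening_iff[OF \<open>j \<in> P\<close> a]
  fix y1 y2 y
  assume y1: "y1 \<in> fibre P j (box_thickening X a) g" and y2: "y2 \<in> fibre P j (box_thickening X a) g"
    and "y1 \<le> y \<and> y \<le> y2"
  obtain x where "x \<in> X" "\<bar>y1 - x$j\<bar> \<le> a j" and near: "\<forall>i\<in>P - {j}. \<bar>g i - x$i\<bar> \<le> a i"
    using y1 unfolding fibre_iff by blast
  obtain x' where "x' \<in> X" "\<bar>y2 - x'$j\<bar> \<le> a j" and near': "\<forall>i\<in>P - {j}. \<bar>g i - x'$i\<bar> \<le> a i"
    using y2 unfolding fibre_iff by blast
  obtain D :: real and \<gamma> where "0 \<le> D" and "continuous_on {0..D} \<gamma>" and "\<gamma> 0 = x" and "\<gamma> D = x'"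
    and \<gamma>_in: "\<gamma> ` {0..D} \<subseteq> X \<inter> cbox (inf x x') (sup x x')"
    using X \<open>x \<in> X\<close> \<open>x' \<in> X\<close> unfolding box_path_connected_def by blast
  txt \<open>Either \<open>y\<close> is within \<open>a j\<close> of an endpoint, or the \<open>j\<close>-th coordinate of the path passes
    through \<open>y\<close>; the other coordinates of the path stay between those of \<open>x\<close> and \<open>x'\<close>.\<close>
  obtain t where t: "t \<in> {0..D}" and "\<bar>y - \<gamma> t $ j\<bar> \<le> a j"
  proof (cases "\<bar>y - x$j\<bar> \<le> a j \<or> \<bar>y - x'$j\<bar> \<le> a j")
    case True
    then show ?thesis using that[of 0] that[of D] \<open>0 \<le> D\<close> \<open>\<gamma> 0 = x\<close> \<open>\<gamma> D = x'\<close> by auto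
  next
    case False
    then have "x$j \<le> y" "y \<le> x'$j"
      using \<open>\<bar>y1 - x$j\<bar> \<le> a j\<close> \<open>\<bar>y2 - x'$j\<bar> \<le> a j\<close> \<open>y1 \<le> y \<and> y \<le> y2\<close> by auto
    moreover have "continuous_on {0..D} (\<lambda>t. \<gamma> t $ j)"
      using \<open>continuous_on {0..D} \<gamma>\<close> by (rule continuous_on_component)
    ultimately obtain t where "0 \<le> t" "t \<le> D" "\<gamma> t $ j = y"
      using IVT'[of "\<lambda>t. \<gamma> t $ j" 0 y D] \<open>0 \<le> D\<close> \<open>\<gamma> 0 = x\<close> \<open>\<gamma> D = x'\<close> by auto
    then show ?thesis using that[of t] a by auto
  qed
  have "\<gamma> t \<in> X" "\<gamma> t \<in> cbox (inf x x') (sup x x')" using \<gamma>_in t by blast+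
  then have "min (x$i) (x'$i) \<le> \<gamma> t $ i" "\<gamma> t $ i \<le> max (x$i) (x'$i)" for i
    by (simp_all add: mem_box_cart inf_vec_def sup_vec_def inf_min sup_max)
  then have "\<forall>i\<in>P - {j}. \<bar>g i - \<gamma> t $ i\<bar> \<le> a i"
    using near near' abs_diff_le_if_between by blast
  moreover have "\<forall>i. i \<notin> P \<longrightarrow> g i = undefined" using y1 unfolding fibre_iff by blast
  ultimately show "y \<in> fibre P j (box_thickening X a) g"
    unfolding fibre_iff using \<open>\<gamma> t \<in> X\<close> \<open>\<bar>y - \<gamma> t $ j\<bar> \<le> a j\<close> by blast
qed

lemma fibre_box_thickening_widen:
  fixes X :: "(real^'n) set"
  assumes "j \<in> P" and a: "\<forall>i. 0 \<le> a i" "a j = 0" and "0 \<le> c"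
  shows "fibre P j (box_thickening X (a(j := c))) g =
         {y. \<exists>t. \<bar>t\<bar> \<le> c \<and> y - t \<in> fibre P j (box_thickening X a) g}"
proof -
  have "\<forall>i. 0 \<le> (a(j := c)) i" using a \<open>0 \<le> c\<close> by simp
  note widened = mem_fibre_box_thickening_iff[OF \<open>j \<in> P\<close> this]
    and original = mem_fibre_box_thickening_iff[OF \<open>j \<in> P\<close> a(1)]
  have same_off_j: "(\<forall>i\<in>P - {j}. \<bar>g i - w$i\<bar> \<le> (a(j := c)) i) \<longleftrightarrow>
      (\<forall>i\<in>P - {j}. \<bar>g i - w$i\<bar> \<le> a i)" for w :: "real^'n"
    by auto
  show ?thesis
  proof (intro set_eqI iffI)
    fix y assume "y \<in> fibre P j (box_thickening X (a(j := c))) g"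
    then obtain w where "\<forall>i. i \<notin> P \<longrightarrow> g i = undefined" "w \<in> X" "\<bar>y - w$j\<bar> \<le> c"
      "\<forall>i\<in>P - {j}. \<bar>g i - w$i\<bar> \<le> a i"
      unfolding widened same_off_j by auto
    moreover from this have "y - (y - w$j) \<in> fibre P j (box_thickening X a) g"
      unfolding original using a(2) by (auto intro!: bexI[of _ w])
    ultimately show "y \<in> {y. \<exists>t. \<bar>t\<bar> \<le> c \<and> y - t \<in> fibre P j (box_thickening X a) g}"
      by blast
  next
    fix y assume "y \<in> {y. \<exists>t. \<bar>t\<bar> \<le> c \<and> y - t \<in> fibre P j (box_thickening X a) g}"
    then obtain t w where "\<bar>t\<bar> \<le> c" "\<forall>i. i \<notin> P \<longrightarrow> g i = undefined"
      and "w \<in> X" "\<bar>y - t - w$j\<bar> \<le> 0" "\<forall>i\<in>P - {j}. \<bar>g i - w$i\<bar> \<le> a i"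
      unfolding original using a(2) by auto
    then show "y \<in> fibre P j (box_thickening X (a(j := c))) g"
      unfolding widened same_off_j by (auto intro!: bexI[of _ w])
  qed
qed

lemma emeasure_interval_widen:
  fixes F :: "real set"
  assumes "compact F" and "is_interval F" and "0 \<le> c"
  shows "emeasure lborel {y. \<exists>t. \<bar>t\<bar> \<le> c \<and> y - t \<in> F} =
         emeasure lborel F + (if F = {} then 0 else ennreal (2 * c))"
proof (cases "F = {}")
  case False
  obtain l u where F: "F = {l..u}"
    using assms(1,2) is_interval_compact[of F] by (metis cbox_interval)
  with False have "l \<le> u" by auto
  have "{y. \<exists>t. \<bar>t\<bar> \<le> c \<and> y - t \<in> F} = {l - c..u + c}"
  proof (intro set_eqI iffI)
    fix y assume "y \<in> {l - c..u + c}"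
    then have "\<bar>y - min u (max l y)\<bar> \<le> c \<and> y - (y - min u (max l y)) \<in> F"
      using \<open>l \<le> u\<close> \<open>0 \<le> c\<close> unfolding F by (auto simp: abs_le_iff min_def max_def)
    then show "y \<in> {y. \<exists>t. \<bar>t\<bar> \<le> c \<and> y - t \<in> F}" by blast
  next
    fix y assume "y \<in> {y. \<exists>t. \<bar>t\<bar> \<le> c \<and> y - t \<in> F}"
    then obtain t where "\<bar>t\<bar> \<le> c" "l \<le> y - t" "y - t \<le> u" unfolding F by auto
    then show "y \<in> {l - c..u + c}" by (simp add: abs_le_iff)
  qed
  moreover have "ennreal (u + c - (l - c)) = ennreal (u - l) + ennreal (2 * c)"
    using \<open>l \<le> u\<close> \<open>0 \<le> c\<close> by (subst ennreal_plus[symmetric]) (simp_all add: algebra_simps)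
  ultimately show ?thesis
    using F False \<open>l \<le> u\<close> \<open>0 \<le> c\<close> by simp
qed simp

section \<open>Measures of coordinate projections\<close>

abbreviation coord_lborel :: "'n set \<Rightarrow> ('n \<Rightarrow> real) measure" where
  "coord_lborel P \<equiv> PiM P (\<lambda>_. lborel)"

lemma emeasure_slice_eq_nn_integral:
  assumes "S \<in> sets (coord_lborel (insert j Q))" and "g \<in> space (coord_lborel Q)" and "j \<notin> Q"
  shows "emeasure lborel {y. g(j := y) \<in> S} = (\<integral>\<^sup>+y. indicator S (g(j := y)) \<partial>lborel)"
proof -
  have "(\<lambda>y. g(j := y)) \<in> measurable lborel (coord_lborel (insert j Q))"
    using measurable_component_update[OF assms(2,3)] by simp
  from measurable_sets[OF this assms(1)] have "{y. g(j := y) \<in> S} \<in> sets lborel"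
    by (simp add: vimage_def)
  moreover have "indicator S (g(j := y)) = (indicator {y. g(j := y) \<in> S} y :: ennreal)" for y
    by (simp add: indicator_def)
  ultimately show ?thesis by simp
qed

lemma emeasure_coord_lborel_insert:
  fixes Q :: "'n::finite set"
  assumes "S \<in> sets (coord_lborel (insert j Q))" and "j \<notin> Q"
  shows "emeasure (coord_lborel (insert j Q)) S =
         (\<integral>\<^sup>+g. emeasure lborel {y. g(j := y) \<in> S} \<partial>coord_lborel Q)"
proof -
  interpret product_sigma_finite "\<lambda>_::'n. lborel :: real measure" by standard
  have "emeasure (coord_lborel (insert j Q)) S = (\<integral>\<^sup>+x. indicator S x \<partial>coord_lborel (insert j Q))"
    using assms(1) by simp
  also have "\<dots> = (\<integral>\<^sup>+g. (\<integral>\<^sup>+y. indicator S (g(j := y)) \<partial>lborel) \<partial>coord_lborel Q)"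
    using assms by (intro product_nn_integral_insert) auto
  also have "\<dots> = (\<integral>\<^sup>+g. emeasure lborel {y. g(j := y) \<in> S} \<partial>coord_lborel Q)"
    using assms by (intro nn_integral_cong) (simp add: emeasure_slice_eq_nn_integral)
  finally show ?thesis .
qed

lemma borel_measurable_emeasure_slice:
  assumes "S \<in> sets (coord_lborel (insert j Q))" and "j \<notin> Q"
  shows "(\<lambda>g. emeasure lborel {y. g(j := y) \<in> S}) \<in> borel_measurable (coord_lborel Q)"
proof -
  have "(\<lambda>(g, y). indicator S (g(j := y)) :: ennreal) \<in> borel_measurable (coord_lborel Q \<Otimes>\<^sub>M lborel)"
    using assms(1) by measurable
  then have "(\<lambda>g. \<integral>\<^sup>+y. indicator S (g(j := y)) \<partial>lborel) \<in> borel_measurable (coord_lborel Q)"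
    by (rule lborel.borel_measurable_nn_integral)
  then show ?thesis
    by (rule measurable_cong[THEN iffD1, rotated])
      (use emeasure_slice_eq_nn_integral[OF assms(1) _ assms(2)] in simp)
qed

definition coord_embed :: "'n set \<Rightarrow> ('n \<Rightarrow> real) \<Rightarrow> real^'n" where
  "coord_embed P f = (\<chi> i. if i \<in> P then f i else 0)"

lemma measurable_coord_embed:
  fixes P :: "'n::finite set"
  shows "coord_embed P \<in> borel_measurable (coord_lborel P)"
proof (rule borel_measurable_euclidean_space[THEN iffD2], intro ballI)
  fix b :: "real^'n" assume "b \<in> Basis"
  then obtain i where b: "b = axis i 1" by (auto simp: Basis_vec_def)
  have "(\<lambda>f. if i \<in> P then f i else 0) \<in> borel_measurable (coord_lborel P)"
    by (cases "i \<in> P") (simp_all add: measurable_component_singleton)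
  then show "(\<lambda>f. coord_embed P f \<bullet> b) \<in> borel_measurable (coord_lborel P)"
    by (simp add: b coord_embed_def inner_axis)
qed

lemma coord_proj_in_space: "coord_proj P z \<in> space (coord_lborel P)"
  by (simp add: space_PiM coord_proj_def)

lemma inj_on_coord_embed: "inj_on (coord_embed P) (space (coord_lborel P))"
proof (rule inj_onI, rule ext)
  fix f g i assume f: "f \<in> space (coord_lborel P)" and g: "g \<in> space (coord_lborel P)"
    and eq: "coord_embed P f = coord_embed P g"
  show "f i = g i"
  proof (cases "i \<in> P")
    case True
    then show ?thesis using arg_cong[OF eq, of "\<lambda>v. v$i"] by (simp add: coord_embed_def)
  next
    case False
    have "f \<in> PiE P (\<lambda>_. UNIV)" "g \<in> PiE P (\<lambda>_. UNIV)" using f g by (simp_all add: space_PiM)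
    then show ?thesis using False by (metis PiE_arb)
  qed
qed

lemma sets_coord_proj_compact:
  fixes T :: "(real^'n) set"
  assumes "compact T"
  shows "coord_proj P ` T \<in> sets (coord_lborel P)"
proof -
  have "coord_embed P \<circ> coord_proj P = (\<lambda>z. \<chi> i. if i \<in> P then z$i else 0)"
    by (auto simp: fun_eq_iff coord_embed_def coord_proj_def)
  moreover have "continuous_on T (\<lambda>z. \<chi> i. if i \<in> P then z$i else 0)"
    by (intro continuous_on_vec_lambda, rename_tac i, case_tac "i \<in> P")
      (simp_all add: continuous_on_component)
  ultimately have "(coord_embed P \<circ> coord_proj P) ` T \<in> sets borel"
    using assms by (simp add: borel_compact compact_continuous_image)
  moreover have "coord_proj P ` T =
      coord_embed P -` ((coord_embed P \<circ> coord_proj P) ` T) \<inter> space (coord_lborel P)"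
    using inj_on_coord_embed[of P] coord_proj_in_space[of P]
    by (auto simp: inj_on_def image_iff)
  ultimately show ?thesis
    using measurable_sets[OF measurable_coord_embed] by metis
qed

lemma emeasure_coord_proj_compact:
  fixes T :: "(real^'n) set"
  assumes "compact T"
  shows "emeasure (coord_lborel P) (coord_proj P ` T) = ennreal (proj_vol P T)"
proof -
  interpret product_sigma_finite "\<lambda>_::'n. lborel :: real measure" by standard
  obtain R where R: "\<And>z. z \<in> T \<Longrightarrow> norm z \<le> R"
    using compact_imp_bounded[OF assms] bounded_iff by blast
  have "coord_proj P ` T \<subseteq> PiE P (\<lambda>_. {-R..R})"
  proof (rule image_subsetI)
    fix z assume "z \<in> T"
    then have "\<bar>z$i\<bar> \<le> R" for i using R component_le_norm_cart order_trans by blast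
    then show "coord_proj P z \<in> PiE P (\<lambda>_. {-R..R})"
      by (force simp: coord_proj_def abs_le_iff)
  qed
  then have "emeasure (coord_lborel P) (coord_proj P ` T) \<le> emeasure (coord_lborel P) (PiE P (\<lambda>_. {-R..R}))"
    by (intro emeasure_mono sets_PiM_I_finite) auto
  also have "\<dots> = (\<Prod>i\<in>P. emeasure lborel {-R..R})"
    by (intro emeasure_PiM) simp_all
  also have "\<dots> < \<infinity>"
    by (simp add: power_less_top_ennreal emeasure_lborel_Icc_eq)
  finally show ?thesis
    by (simp add: proj_vol_def emeasure_eq_ennreal_measure)
qed

lemma emeasure_coord_proj_eq_nn_integral_fibre:
  fixes T :: "(real^'n) set"
  assumes "compact T" and "j \<in> P"
  shows "emeasure (coord_lborel P) (coord_proj P ` T) =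
           (\<integral>\<^sup>+g. emeasure lborel (fibre P j T g) \<partial>coord_lborel (P - {j}))"
    and "(\<lambda>g. emeasure lborel (fibre P j T g)) \<in> borel_measurable (coord_lborel (P - {j}))"
proof -
  have P: "insert j (P - {j}) = P" "j \<notin> P - {j}" using \<open>j \<in> P\<close> by auto
  have S: "coord_proj P ` T \<in> sets (coord_lborel (insert j (P - {j})))"
    using sets_coord_proj_compact[OF \<open>compact T\<close>] by (simp only: P(1))
  show "emeasure (coord_lborel P) (coord_proj P ` T) =
      (\<integral>\<^sup>+g. emeasure lborel (fibre P j T g) \<partial>coord_lborel (P - {j}))"
    using emeasure_coord_lborel_insert[OF S P(2)] unfolding P(1) by (simp only: fibre_def)
  show "(\<lambda>g. emeasure lborel (fibre P j T g)) \<in> borel_measurable (coord_lborel (P - {j}))"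
    using borel_measurable_emeasure_slice[OF S P(2)] unfolding P(1) by (simp only: fibre_def)
qed

lemma emeasure_fibre_box_thickening_widen:
  fixes X :: "(real^'n) set"
  assumes X: "compact X" "box_path_connected X" and "j \<in> P"
    and a: "\<forall>i. 0 \<le> a i" "a j = 0" and "0 \<le> c" and g: "g \<in> space (coord_lborel (P - {j}))"
  shows "emeasure lborel (fibre P j (box_thickening X (a(j := c))) g) =
         emeasure lborel (fibre P j (box_thickening X a) g)
         + ennreal (2 * c) * indicator (coord_proj (P - {j}) ` box_thickening X a) g"
proof -
  let ?F = "fibre P j (box_thickening X a) g"
  have "g \<in> extensional (P - {j})" using g by (simp add: space_PiM PiE_def)
  have "emeasure lborel (fibre P j (box_thickening X (a(j := c))) g) =
      emeasure lborel {y. \<exists>t. \<bar>t\<bar> \<le> c \<and> y - t \<in> ?F}"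
    by (simp only: fibre_box_thickening_widen[OF \<open>j \<in> P\<close> a \<open>0 \<le> c\<close>])
  also have "\<dots> = emeasure lborel ?F + (if ?F = {} then 0 else ennreal (2 * c))"
    using compact_fibre[OF compact_box_thickening[OF X(1)] \<open>j \<in> P\<close> \<open>g \<in> extensional _\<close>]
      is_interval_fibre_box_thickening[OF X(2) a(1) \<open>j \<in> P\<close>] \<open>0 \<le> c\<close>
    by (rule emeasure_interval_widen)
  also have "\<dots> = emeasure lborel ?F
      + ennreal (2 * c) * indicator (coord_proj (P - {j}) ` box_thickening X a) g"
    using fibre_eq_empty_iff[OF \<open>j \<in> P\<close> \<open>g \<in> extensional _\<close>] by (simp add: indicator_def)
  finally show ?thesis .
qed

lemma emeasure_box_thickening_widen:
  fixes X :: "(real^'n) set"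
  assumes X: "compact X" "box_path_connected X" and "j \<in> P"
    and a: "\<forall>i. 0 \<le> a i" "a j = 0" and "0 \<le> c"
  shows "emeasure (coord_lborel P) (coord_proj P ` box_thickening X (a(j := c))) =
         emeasure (coord_lborel P) (coord_proj P ` box_thickening X a)
         + ennreal (2 * c) * emeasure (coord_lborel (P - {j})) (coord_proj (P - {j}) ` box_thickening X a)"
proof -
  let ?Q = "P - {j}" and ?Y = "box_thickening X a"
  note fibres = emeasure_coord_proj_eq_nn_integral_fibre[OF compact_box_thickening[OF X(1)] \<open>j \<in> P\<close>]
  have "emeasure (coord_lborel P) (coord_proj P ` box_thickening X (a(j := c))) =
      (\<integral>\<^sup>+g. emeasure lborel (fibre P j ?Y g)
             + ennreal (2 * c) * indicator (coord_proj ?Q ` ?Y) g \<partial>coord_lborel ?Q)"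
    unfolding fibres(1)
    by (intro nn_integral_cong emeasure_fibre_box_thickening_widen[OF X \<open>j \<in> P\<close> a \<open>0 \<le> c\<close>])
  also have "\<dots> = (\<integral>\<^sup>+g. emeasure lborel (fibre P j ?Y g) \<partial>coord_lborel ?Q)
      + (\<integral>\<^sup>+g. ennreal (2 * c) * indicator (coord_proj ?Q ` ?Y) g \<partial>coord_lborel ?Q)"
    using fibres(2) sets_coord_proj_compact[OF compact_box_thickening[OF X(1)]]
    by (intro nn_integral_add) auto
  also have "\<dots> = emeasure (coord_lborel P) (coord_proj P ` ?Y)
      + ennreal (2 * c) * emeasure (coord_lborel ?Q) (coord_proj ?Q ` ?Y)"
    using sets_coord_proj_compact[OF compact_box_thickening[OF X(1)]]
    by (simp add: fibres(1) nn_integral_cmult_indicator)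
  finally show ?thesis .
qed

lemma proj_vol_box_thickening_widen:
  fixes X :: "(real^'n) set"
  assumes "compact X" "box_path_connected X" and "j \<in> P"
    and "\<forall>i. 0 \<le> a i" "a j = 0" and "0 \<le> c"
  shows "proj_vol P (box_thickening X (a(j := c))) =
         proj_vol P (box_thickening X a) + 2 * c * proj_vol (P - {j}) (box_thickening X a)"
proof -
  let ?v' = "proj_vol P (box_thickening X (a(j := c)))"
  let ?v = "proj_vol P (box_thickening X a)"
  let ?w = "proj_vol (P - {j}) (box_thickening X a)"
  have "ennreal ?v' = ennreal ?v + ennreal (2 * c) * ennreal ?w"
    using emeasure_box_thickening_widen[OF assms]
    by (simp add: emeasure_coord_proj_compact compact_box_thickening \<open>compact X\<close>)
  also have "\<dots> = ennreal (?v + 2 * c * ?w)"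
    using \<open>0 \<le> c\<close> by (simp add: proj_vol_def ennreal_mult)
  finally have "ennreal ?v' = ennreal (?v + 2 * c * ?w)" .
  then show ?thesis
    using \<open>0 \<le> c\<close> by (subst (asm) ennreal_inj) (simp_all add: proj_vol_def)
qed

lemma sum_Pow_insert_power:
  fixes f :: "'a set \<Rightarrow> real"
  assumes "finite J" and "j \<notin> J"
  shows "(\<Sum>S\<in>Pow (insert j J). f (P - S) * lam ^ card S) =
         (\<Sum>S\<in>Pow J. f (P - S) * lam ^ card S) + lam * (\<Sum>S\<in>Pow J. f (P - {j} - S) * lam ^ card S)"
proof -
  have "lam * (f (P - {j} - S) * lam ^ card S) = f (P - insert j S) * lam ^ card (insert j S)"
    if "S \<in> Pow J" for S
  proof -
    have "finite S" "j \<notin> S" using that assms finite_subset by auto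
    moreover have "P - insert j S = P - {j} - S" by blast
    ultimately show ?thesis by simp
  qed
  then have "lam * (\<Sum>S\<in>Pow J. f (P - {j} - S) * lam ^ card S) =
      (\<Sum>S\<in>Pow J. f (P - insert j S) * lam ^ card (insert j S))"
    by (simp add: sum_distrib_left)
  also have "\<dots> = (\<Sum>S\<in>insert j ` Pow J. f (P - S) * lam ^ card S)"
    using \<open>j \<notin> J\<close> by (subst sum.reindex) (auto simp: inj_on_def)
  finally have "lam * (\<Sum>S\<in>Pow J. f (P - {j} - S) * lam ^ card S) =
      (\<Sum>S\<in>insert j ` Pow J. f (P - S) * lam ^ card S)" .
  moreover have "(\<Sum>S\<in>Pow J \<union> insert j ` Pow J. f (P - S) * lam ^ card S) =
      (\<Sum>S\<in>Pow J. f (P - S) * lam ^ card S) + (\<Sum>S\<in>insert j ` Pow J. f (P - S) * lam ^ card S)"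
    using assms by (intro sum.union_disjoint) auto
  ultimately show ?thesis by (simp add: Pow_insert)
qed

lemma proj_vol_box_thickening:
  fixes X :: "(real^'n) set"
  assumes "compact X" "box_path_connected X" "0 \<le> lam" "J \<subseteq> P"
  shows "proj_vol P (box_thickening X (\<lambda>i. if i \<in> J then lam / 2 else 0)) =
         (\<Sum>S\<in>Pow J. proj_vol (P - S) X * lam ^ card S)"
proof -
  have "finite J" by simp
  from this \<open>J \<subseteq> P\<close> show ?thesis
  proof (induction J arbitrary: P rule: finite_induct)
    case empty
    then show ?case by (simp add: box_thickening_zero)
  next
    case (insert j J)
    let ?a = "\<lambda>i. if i \<in> J then lam / 2 else 0"
    have "j \<in> P" "J \<subseteq> P" "J \<subseteq> P - {j}" using insert by auto
    have a: "\<forall>i. 0 \<le> ?a i" "?a j = 0" using \<open>0 \<le> lam\<close> \<open>j \<notin> J\<close> by auto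
    have "(\<lambda>i. if i \<in> insert j J then lam / 2 else 0) = ?a(j := lam / 2)"
      by (auto simp: fun_eq_iff)
    moreover have "proj_vol P (box_thickening X (?a(j := lam / 2))) =
        proj_vol P (box_thickening X ?a) + 2 * (lam / 2) * proj_vol (P - {j}) (box_thickening X ?a)"
      using \<open>0 \<le> lam\<close> by (intro proj_vol_box_thickening_widen[OF assms(1,2) \<open>j \<in> P\<close> a]) simp
    ultimately show ?case
      using insert.IH[OF \<open>J \<subseteq> P\<close>] insert.IH[OF \<open>J \<subseteq> P - {j}\<close>]
      by (simp add: sum_Pow_insert_power[OF insert.hyps, of "\<lambda>R. proj_vol R X"])
  qed
qed

lemma proj_vol_minkowski_sum_cube:
  fixes X :: "(real^'n) set"
  assumes "compact X" "box_path_connected X" "0 \<le> lam"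
  shows "proj_vol P (minkowski_sum X ((*\<^sub>R) lam ` unit_cube)) =
         (\<Sum>R\<in>Pow P. proj_vol R X * lam ^ (card P - card R))"
proof -
  have "proj_vol P (minkowski_sum X ((*\<^sub>R) lam ` unit_cube)) =
        proj_vol P (box_thickening X (\<lambda>i. if i \<in> P then lam / 2 else 0))"
    using coord_proj_box_thickening_restrict[of "\<lambda>_. lam / 2" P X] \<open>0 \<le> lam\<close>
    by (simp add: proj_vol_def box_thickening_def scaleR_unit_cube)
  also have "\<dots> = (\<Sum>S\<in>Pow P. proj_vol (P - S) X * lam ^ card S)"
    by (rule proj_vol_box_thickening[OF assms order_refl])
  also have "\<dots> = (\<Sum>R\<in>Pow P. proj_vol R X * lam ^ (card P - card R))"
  proof (rule sum.reindex_bij_witness[of _ "\<lambda>R. P - R" "\<lambda>R. P - R"])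
    fix S assume "S \<in> Pow P"
    then have "card (P - S) = card P - card S" "card S \<le> card P"
      by (simp_all add: card_Diff_subset card_mono)
    then show "proj_vol (P - S) X * lam ^ (card P - card (P - S)) =
        proj_vol (P - S) X * lam ^ card S"
      by simp
  qed auto
  finally show ?thesis .
qed

lemma lborel_eq_distr_vec_lambda:
  "(lborel :: (real^'n) measure) = distr (coord_lborel UNIV) borel vec_lambda"
proof (rule lborel_eqI)
  interpret product_sigma_finite "\<lambda>_::'n. lborel :: real measure" by standard
  have meas: "(vec_lambda :: ('n \<Rightarrow> real) \<Rightarrow> real^'n) \<in> borel_measurable (coord_lborel UNIV)"
    using measurable_coord_embed[of "UNIV :: 'n set"] by (simp add: coord_embed_def[abs_def])
  fix l u :: "real^'n"
  assume le: "\<And>b. b \<in> Basis \<Longrightarrow> l \<bullet> b \<le> u \<bullet> b"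
  have le': "l$i \<le> u$i" for i using le[of "axis i 1"] by (simp add: inner_axis)
  have "vec_lambda -` box l u \<inter> space (coord_lborel UNIV) = PiE UNIV (\<lambda>i. {l$i<..<u$i})"
    by (auto simp: space_PiM mem_box_cart PiE_def Pi_def)
  then have "emeasure (distr (coord_lborel UNIV) borel vec_lambda) (box l u) =
      emeasure (coord_lborel UNIV) (PiE UNIV (\<lambda>i. {l$i<..<u$i}))"
    by (subst emeasure_distr[OF meas]) simp_all
  also have "\<dots> = (\<Prod>i\<in>UNIV. emeasure lborel {l$i<..<u$i})"
    by (rule emeasure_PiM) simp_all
  also have "\<dots> = ennreal (\<Prod>i\<in>UNIV. u$i - l$i)"
    using le' by (simp add: prod_ennreal)
  also have "(\<Prod>i\<in>UNIV. u$i - l$i) = (\<Prod>b\<in>Basis. (u - l) \<bullet> b)"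
  proof -
    have B: "(Basis :: (real^'n) set) = (\<lambda>i. axis i 1) ` UNIV"
      unfolding Basis_vec_def Basis_real_def by auto
    have "inj (\<lambda>i::'n. axis i (1::real))" by (auto simp: inj_def axis_eq_axis)
    then show ?thesis unfolding B prod.reindex[OF \<open>inj _\<close>] by (simp add: inner_axis)
  qed
  finally show "emeasure (distr (coord_lborel UNIV) borel vec_lambda) (box l u) =
      (\<Prod>b\<in>Basis. (u - l) \<bullet> b)" .
qed simp

lemma measure_lebesgue_eq_proj_vol_UNIV:
  fixes Y :: "(real^'n) set"
  assumes "compact Y"
  shows "measure lebesgue Y = proj_vol UNIV Y"
proof -
  have meas: "(vec_lambda :: ('n \<Rightarrow> real) \<Rightarrow> real^'n) \<in> borel_measurable (coord_lborel UNIV)"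
    using measurable_coord_embed[of "UNIV :: 'n set"] by (simp add: coord_embed_def[abs_def])
  have "Y \<in> sets borel" using assms by (simp add: borel_compact)
  then have "measure lebesgue Y = measure lborel Y" by simp
  also have "\<dots> = measure (coord_lborel UNIV) (vec_lambda -` Y \<inter> space (coord_lborel UNIV))"
    by (subst lborel_eq_distr_vec_lambda) (rule measure_distr[OF meas \<open>Y \<in> sets borel\<close>])
  also have "vec_lambda -` Y \<inter> space (coord_lborel UNIV) = coord_proj UNIV ` Y"
  proof (intro set_eqI iffI)
    fix f assume "f \<in> vec_lambda -` Y \<inter> space (coord_lborel UNIV)"
    then show "f \<in> coord_proj UNIV ` Y"
      by (auto simp: coord_proj_def intro!: image_eqI[of _ _ "vec_lambda f"])
  qed (auto simp: coord_proj_def space_PiM restrict_UNIV)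
  finally show ?thesis by (simp add: proj_vol_def)
qed

section \<open>Counting coordinate subspaces\<close>

lemma card_supsets_of_card:
  fixes R :: "'n::finite set"
  assumes "card R \<le> k"
  shows "card {P. card P = k \<and> R \<subseteq> P} = (CARD('n) - card R) choose (k - card R)"
proof -
  have "bij_betw (\<lambda>P. P - R) {P. card P = k \<and> R \<subseteq> P} {S. S \<subseteq> - R \<and> card S = k - card R}"
  proof (rule bij_betw_byWitness[where f' = "\<lambda>S. S \<union> R"])
    show "(\<lambda>P. P - R) ` {P. card P = k \<and> R \<subseteq> P} \<subseteq> {S. S \<subseteq> - R \<and> card S = k - card R}"
      by (auto simp: card_Diff_subset)
    show "(\<lambda>S. S \<union> R) ` {S. S \<subseteq> - R \<and> card S = k - card R} \<subseteq> {P. card P = k \<and> R \<subseteq> P}"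
      using assms by (auto simp: card_Un_disjoint disjoint_eq_subset_Compl)
  qed auto
  then have "card {P. card P = k \<and> R \<subseteq> P} = card {S. S \<subseteq> - R \<and> card S = k - card R}"
    by (rule bij_betw_same_card)
  also have "\<dots> = card (- R) choose (k - card R)"
    by (rule n_subsets) simp
  also have "card (- R) = CARD('n) - card R"
    by (simp add: Compl_eq_Diff_UNIV card_Diff_subset)
  finally show ?thesis .
qed

lemma sum_card_subsets_Pow:
  fixes v :: "'n::finite set \<Rightarrow> real"
  assumes "k \<le> CARD('n)"
  shows "(\<Sum>P | card P = k. \<Sum>R\<in>Pow P. v R * lam ^ (card P - card R)) =
         (\<Sum>i=0..k. real ((CARD('n) - i) choose (CARD('n) - k)) * (\<Sum>R | card R = i. v R) * lam ^ (k - i))"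
proof -
  define h where "h R = real (card {P. card P = k \<and> R \<subseteq> P}) * v R * lam ^ (k - card R)"
    for R :: "'n set"
  have "(\<Sum>P | card P = k. \<Sum>R\<in>Pow P. v R * lam ^ (card P - card R)) =
      (\<Sum>P | card P = k. \<Sum>R | R \<in> UNIV \<and> R \<subseteq> P. v R * lam ^ (card P - card R))"
    by (intro sum.cong) auto
  also have "\<dots> = (\<Sum>R\<in>UNIV. \<Sum>P | P \<in> {P. card P = k} \<and> R \<subseteq> P. v R * lam ^ (card P - card R))"
    by (rule sum.swap_restrict) simp_all
  also have "\<dots> = (\<Sum>R\<in>UNIV. h R)"
  proof (rule sum.cong[OF refl])
    fix R :: "'n set"
    have "(\<Sum>P | P \<in> {P. card P = k} \<and> R \<subseteq> P. v R * lam ^ (card P - card R)) =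
        (\<Sum>P | card P = k \<and> R \<subseteq> P. v R * lam ^ (k - card R))"
      by (intro sum.cong) auto
    then show "(\<Sum>P | P \<in> {P. card P = k} \<and> R \<subseteq> P. v R * lam ^ (card P - card R)) = h R"
      by (simp add: h_def)
  qed
  also have "\<dots> = (\<Sum>R\<in>(\<Union>i\<in>{0..k}. {R. card R = i}). h R)"
  proof (rule sum.mono_neutral_right)
    show "\<forall>R\<in>UNIV - (\<Union>i\<in>{0..k}. {R. card R = i}). h R = 0"
      by (auto simp: h_def dest: card_mono[OF finite])
  qed auto
  also have "\<dots> = (\<Sum>i=0..k. \<Sum>R | card R = i. h R)"
    by (rule sum.UNION_disjoint) auto
  also have "\<dots> = (\<Sum>i=0..k. real ((CARD('n) - i) choose (CARD('n) - k)) * (\<Sum>R | card R = i. v R) * lam ^ (k - i))"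
  proof (rule sum.cong[OF refl])
    fix i assume "i \<in> {0..k}"
    then have "(CARD('n) - i) choose (k - i) = (CARD('n) - i) choose (CARD('n) - k)"
      using assms by (subst binomial_symmetric) auto
    then have "h R = real ((CARD('n) - i) choose (CARD('n) - k)) * v R * lam ^ (k - i)"
      if "card R = i" for R
      using that \<open>i \<in> {0..k}\<close> card_supsets_of_card[of R k] by (simp add: h_def)
    then show "(\<Sum>R | card R = i. h R) =
        real ((CARD('n) - i) choose (CARD('n) - k)) * (\<Sum>R | card R = i. v R) * lam ^ (k - i)"
      by (simp add: sum_distrib_left sum_distrib_right mult.assoc)
  qed
  finally show ?thesis .
qed

theorem theorem6p2:
  fixes X :: "(real^'n) set" and lam :: real
  assumes "compact X" and "l1_convex X" and "lam \<ge> 0"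
  shows "(\<forall>k\<le>CARD('n).
           l1_intrinsic_volume k (minkowski_sum X ((*\<^sub>R) lam ` unit_cube)) =
           (\<Sum>i=0..k. real ((CARD('n) - i) choose (CARD('n) - k))
                        * l1_intrinsic_volume i X * lam ^ (k - i)))
       \<and> measure lebesgue (minkowski_sum X ((*\<^sub>R) lam ` unit_cube)) =
           (\<Sum>i=0..CARD('n). l1_intrinsic_volume i X * lam ^ (CARD('n) - i))"
proof -
  define Y where "Y = minkowski_sum X ((*\<^sub>R) lam ` unit_cube)"
  have X: "box_path_connected X" using \<open>l1_convex X\<close> by (rule l1_convex_imp_box_path_connected)
  have intrinsic: "l1_intrinsic_volume k Y =
      (\<Sum>i=0..k. real ((CARD('n) - i) choose (CARD('n) - k)) * l1_intrinsic_volume i X * lam ^ (k - i))"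
    if "k \<le> CARD('n)" for k
    using sum_card_subsets_Pow[OF that, of "\<lambda>R. proj_vol R X" lam]
      proj_vol_minkowski_sum_cube[OF \<open>compact X\<close> X \<open>lam \<ge> 0\<close>]
    by (simp add: l1_intrinsic_volume_def Y_def)
  have "compact Y"
    using compact_box_thickening[OF \<open>compact X\<close>]
    by (simp add: Y_def scaleR_unit_cube \<open>lam \<ge> 0\<close> box_thickening_def)
  moreover have "{P :: 'n set. card P = CARD('n)} = {UNIV}"
    using card_subset_eq[OF finite_class.finite_UNIV subset_UNIV] by auto
  ultimately have "measure lebesgue Y = l1_intrinsic_volume (CARD('n)) Y"
    by (simp add: measure_lebesgue_eq_proj_vol_UNIV l1_intrinsic_volume_def)
  also have "\<dots> = (\<Sum>i=0..CARD('n). l1_intrinsic_volume i X * lam ^ (CARD('n) - i))"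
    by (simp add: intrinsic)
  finally show ?thesis using intrinsic by (simp add: Y_def)
qed

end
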